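(* Let $\mathbb K\in\{\mathbb R,\mathbb C\}$ and let $X$ be a $\mathbb K$-Banach space with $\dim_{\mathbb K}X>1$. Then the set $\mathcal I(X)$ of idempotents in $\mathcal L(X)\setminus\{0,I\}$, under the norm topology, is canonically homeomorphic to the subspace $$\{(E,F)\in\mathscr G(X)\times\mathscr G(X):E\text{ and }F\text{ are complements of each other}\}$$ of the product topological space $\mathscr G(X)\times\mathscr G(X)$; namely, the bijection $Q\mapsto(Q(X),\ker Q)$ is a homeomorphism.
   Context: $\mathcal L(X,Y)$ is the Banach space of bounded $\mathbb K$-linear operators and $\mathcal L(X)=\mathcal L(X,X)$. $\mathscr G(X)$ is the set of all non-zero proper closed complemented subspaces of $X$. For $F\in\mathscr G(X)$, $\mathcal C_F$ is the set of closed complements of $F$ in $X$. For $E\in\mathcal C_F$ the map $q_{E,F}:\mathcal L(E,F)\to\mathcal C_F$, $q_{E,F}(T)=(I+T)(E)$, is a bijection with inverse $p_{E,F}$. $\mathscr G(X)$ carries the Hausdorff metrizable topology in which each $\mathcal C_F$ is open and each $p_{E,F}:\mathcal C_F\to\mathcal L(E,F)$ is a homeomorphism (the topology of the Grassmann manifold). $\mathcal I(X)=\{Q\in\mathcal L(X)\setminus\{0,I\}:Q^2=Q\}$. *)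

theory Defs
  imports "HOL-Analysis.Analysis"
begin

text \<open>
  The scalar field is \<open>\<real>\<close> or \<open>\<complex>\<close>. In the second case the absolute value is automatically the
  usual one, since a multiplicative norm on \<open>\<complex>\<close> extending that of \<open>\<real>\<close> is unique.
\<close>

class real_or_complex = real_normed_field +
  assumes real_or_complex:
    "(\<forall>x. \<exists>a. x = a *\<^sub>R 1) \<or>
     (\<exists>i. i * i = - 1 \<and> (\<forall>x. \<exists>a b. x = a *\<^sub>R 1 + b *\<^sub>R i))"

instance real :: real_or_complex
  by standard auto

instance complex :: real_or_complex
  proof
  have "x = Re x *\<^sub>R 1 + Im x *\<^sub>R \<i>" for x
    by (simp add: complex_eq_iff)
  then show "(\<forall>x::complex. \<exists>a. x = a *\<^sub>R 1) \<or>
      (\<exists>i::complex. i * i = - 1 \<and> (\<forall>x. \<exists>a b. x = a *\<^sub>R 1 + b *\<^sub>R i))"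
    using i_squared by blast
qed

text \<open>
  A Banach space over \<open>'k\<close> is a real Banach space together with a multiplication by scalars from
  \<open>'k\<close> that extends multiplication by reals and for which the norm is homogeneous.
\<close>

locale banach_space_over = vector_space smul
  for smul :: "'k::real_or_complex \<Rightarrow> 'a::banach \<Rightarrow> 'a" +
  assumes scale_of_real: "smul (of_real r) x = r *\<^sub>R x"
    and norm_scale: "norm (smul c x) = norm c * norm x"

lemma banach_space_over_real:
  "banach_space_over (scaleR :: real \<Rightarrow> 'a::banach \<Rightarrow> 'a)"
  by unfold_locales (auto simp: algebra_simps)

lemma banach_space_over_complex:
  "banach_space_over ((*) :: complex \<Rightarrow> complex \<Rightarrow> complex)"
  by unfold_locales (auto simp: algebra_simps norm_mult scaleR_conv_of_real)

text \<open>
  The constant \<open>dim\<close> is 0 on infinite-dimensional spaces, so the dimension is read off a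
  (Hamel) basis.
\<close>

definition dim_gt_one :: "('k::real_or_complex \<Rightarrow> 'a::banach \<Rightarrow> 'a) \<Rightarrow> bool" where
  "dim_gt_one smul \<longleftrightarrow>
     (\<exists>B. \<not> module.dependent smul B \<and> module.span smul B = UNIV \<and> (infinite B \<or> 1 < card B))"

definition closed_subspace :: "('k::real_or_complex \<Rightarrow> 'a::banach \<Rightarrow> 'a) \<Rightarrow> 'a set \<Rightarrow> bool" where
  "closed_subspace smul E \<longleftrightarrow> module.subspace smul E \<and> closed E"

definition complementary :: "'a::banach set \<Rightarrow> 'a set \<Rightarrow> bool" where
  "complementary E F \<longleftrightarrow> E \<inter> F = {0} \<and> {x + y | x y. x \<in> E \<and> y \<in> F} = UNIV"

definition closed_complements ::
    "('k::real_or_complex \<Rightarrow> 'a::banach \<Rightarrow> 'a) \<Rightarrow> 'a set \<Rightarrow> 'a set set" where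
  "closed_complements smul F = {E. closed_subspace smul E \<and> complementary E F}"

definition grassmannian :: "('k::real_or_complex \<Rightarrow> 'a::banach \<Rightarrow> 'a) \<Rightarrow> 'a set set" where
  "grassmannian smul =
     {E. closed_subspace smul E \<and> E \<noteq> {0} \<and> E \<noteq> UNIV \<and> closed_complements smul E \<noteq> {}}"


text \<open>
  The space \<open>\<L>(E,F)\<close> for subspaces \<open>E\<close> and \<open>F\<close>: its elements are functions on the
  whole type, made unique by requiring the value \<open>undefined\<close> outside \<open>E\<close>.
\<close>

definition bounded_ops ::
    "('k::real_or_complex \<Rightarrow> 'a::banach \<Rightarrow> 'a) \<Rightarrow> 'a set \<Rightarrow> 'a set \<Rightarrow> ('a \<Rightarrow> 'a) set" where
  "bounded_ops smul E F =
     {T \<in> E \<rightarrow>\<^sub>E F.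
        (\<forall>x\<in>E. \<forall>y\<in>E. T (x + y) = T x + T y) \<and>
        (\<forall>c. \<forall>x\<in>E. T (smul c x) = smul c (T x)) \<and>
        (\<exists>C. \<forall>x\<in>E. norm (T x) \<le> C * norm x)}"

definition op_norm :: "'a::banach set \<Rightarrow> ('a \<Rightarrow> 'a) \<Rightarrow> real" where
  "op_norm E T = (SUP x\<in>{x \<in> E. norm x \<le> 1}. norm (T x))"

text \<open>
  The locale \<open>Metric_space\<close> demands non-negativity and symmetry of the distance also outside
  the carrier; hence the case distinction.
\<close>

definition op_dist ::
    "('k::real_or_complex \<Rightarrow> 'a::banach \<Rightarrow> 'a) \<Rightarrow> 'a set \<Rightarrow> 'a set \<Rightarrow> ('a \<Rightarrow> 'a) \<Rightarrow> ('a \<Rightarrow> 'a) \<Rightarrow> real" where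
  "op_dist smul E F S T =
     (if S \<in> bounded_ops smul E F \<and> T \<in> bounded_ops smul E F
      then op_norm E (\<lambda>x. S x - T x) else 0)"

definition op_topology ::
    "('k::real_or_complex \<Rightarrow> 'a::banach \<Rightarrow> 'a) \<Rightarrow> 'a set \<Rightarrow> 'a set \<Rightarrow> ('a \<Rightarrow> 'a) topology" where
  "op_topology smul E F = Metric_space.mtopology (bounded_ops smul E F) (op_dist smul E F)"

lemma bdd_above_op_norm:
  assumes "S \<in> bounded_ops smul E F" "T \<in> bounded_ops smul E F"
  shows "bdd_above ((\<lambda>x. norm (S x - T x)) ` {x \<in> E. norm x \<le> 1})"
proof -
  obtain C D where C: "\<forall>x\<in>E. norm (S x) \<le> C * norm x" and D: "\<forall>x\<in>E. norm (T x) \<le> D * norm x"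
    using assms by (auto simp: bounded_ops_def)
  have "norm (S x - T x) \<le> \<bar>C\<bar> + \<bar>D\<bar>" if x: "x \<in> E" "norm x \<le> 1" for x
  proof -
    have "C * norm x \<le> \<bar>C\<bar> * 1" "D * norm x \<le> \<bar>D\<bar> * 1"
      using x by (intro mult_mono; simp)+
    with C D x show ?thesis
      using norm_triangle_ineq4[of "S x" "T x"] by fastforce
  qed
  then show ?thesis
    by (intro bdd_aboveI[of _ "\<bar>C\<bar> + \<bar>D\<bar>"]) auto
qed

lemma norm_le_op_dist:
  assumes "S \<in> bounded_ops smul E F" "T \<in> bounded_ops smul E F" "x \<in> E" "norm x \<le> 1"
  shows "norm (S x - T x) \<le> op_dist smul E F S T"
  using assms bdd_above_op_norm[OF assms(1,2)]
  by (auto simp: op_dist_def op_norm_def intro: cSUP_upper2)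

lemma (in banach_space_over) Metric_space_bounded_ops:
  assumes E: "closed_subspace smul E"
  shows "Metric_space (bounded_ops smul E F) (op_dist smul E F)"
proof
  have sub: "subspace E" using E by (simp add: closed_subspace_def)
  have 0: "0 \<in> E" using sub by (rule subspace_0)
  have nn: "0 \<le> op_dist smul E F S T" for S T
  proof (cases "S \<in> bounded_ops smul E F \<and> T \<in> bounded_ops smul E F")
    case True
    then have "norm (S 0 - T 0) \<le> op_dist smul E F S T"
      by (intro norm_le_op_dist) (auto simp: 0)
    then show ?thesis using norm_ge_zero order_trans by blast
  qed (auto simp: op_dist_def)
  show "0 \<le> op_dist smul E F S T" for S T by (rule nn)
  show "op_dist smul E F S T = op_dist smul E F T S" for S T
    by (auto simp: op_dist_def op_norm_def norm_minus_commute)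
  have ne: "{x \<in> E. norm x \<le> 1} \<noteq> {}" using 0 by auto
  show "op_dist smul E F R T \<le> op_dist smul E F R S + op_dist smul E F S T"
    if m: "R \<in> bounded_ops smul E F" "S \<in> bounded_ops smul E F" "T \<in> bounded_ops smul E F"
    for R S T
  proof -
    have "norm (R x - T x) \<le> op_dist smul E F R S + op_dist smul E F S T"
      if "x \<in> E" "norm x \<le> 1" for x
      using norm_le_op_dist[OF m(1,2) that] norm_le_op_dist[OF m(2,3) that]
        norm_triangle_ineq[of "R x - S x" "S x - T x"] by simp
    then have "op_norm E (\<lambda>x. R x - T x) \<le> op_dist smul E F R S + op_dist smul E F S T"
      unfolding op_norm_def by (intro cSUP_least[OF ne]) auto
    then show ?thesis using m by (simp add: op_dist_def[of smul E F R T])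
  qed
  show "(op_dist smul E F S T = 0) = (S = T)"
    if m: "S \<in> bounded_ops smul E F" "T \<in> bounded_ops smul E F" for S T
  proof
    assume z: "op_dist smul E F S T = 0"
    have eq: "S x = T x" if x: "x \<in> E" for x
    proof (cases "x = 0")
      case False
      define r where "r = inverse (norm x)"
      have y: "smul (of_real r) x \<in> E" using sub x by (rule subspace_scale)
      have "norm (smul (of_real r) x) \<le> 1"
        using False by (simp only: scale_of_real r_def norm_scaleR) simp
      then have "S (smul (of_real r) x) = T (smul (of_real r) x)"
        using norm_le_op_dist[OF m y] z by simp
      then have "r *\<^sub>R S x = r *\<^sub>R T x"
        using m x by (simp add: bounded_ops_def flip: scale_of_real)
      then show ?thesis using False by (simp add: r_def)
    next
      case True
      then show ?thesis using norm_le_op_dist[OF m x] z by simp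
    qed
    have "S \<in> extensional E" "T \<in> extensional E"
      using m by (auto simp: bounded_ops_def PiE_def)
    then show "S = T" using eq by (rule extensionalityI)
  next
    assume "S = T"
    then show "op_dist smul E F S T = 0" using m ne by (simp add: op_dist_def op_norm_def)
  qed
qed

definition graph_map :: "'a::banach set \<Rightarrow> ('a \<Rightarrow> 'a) \<Rightarrow> 'a set" where
  "graph_map E T = (\<lambda>x. x + T x) ` E"

text \<open>
  The topology of the Grassmann manifold: a set is open iff its preimage under every chart
  parametrization \<open>q\<^bsub>E,F\<^esub> = graph_map E : \<L>(E,F) \<rightarrow> \<C>\<^sub>F\<close> is open. Lemma
  \<open>grassmann_topology_unique\<close> shows that there is no other candidate for a topology making
  every \<open>\<C>\<^sub>F\<close> open and every \<open>q\<^bsub>E,F\<^esub>\<close> a homeomorphism.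
\<close>

definition grassmann_topology ::
    "('k::real_or_complex \<Rightarrow> 'a::banach \<Rightarrow> 'a) \<Rightarrow> 'a set topology" where
  "grassmann_topology smul = topology (\<lambda>U. U \<subseteq> grassmannian smul \<and>
     (\<forall>F \<in> grassmannian smul. \<forall>E \<in> closed_complements smul F.
        openin (op_topology smul E F) {T \<in> bounded_ops smul E F. graph_map E T \<in> U}))"

lemma (in banach_space_over) topspace_op_topology:
  assumes "closed_subspace smul E"
  shows "topspace (op_topology smul E F) = bounded_ops smul E F"
  using Metric_space.topspace_mtopology[OF Metric_space_bounded_ops[OF assms]]
  by (simp add: op_topology_def)

lemma complementary_sym: "complementary E F \<Longrightarrow> complementary F E"
  unfolding complementary_def set_eq_iff by (simp, metis add.commute)

lemma closed_complements_grassmannian: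
  assumes "F \<in> grassmannian smul" "E \<in> closed_complements smul F"
  shows "E \<in> grassmannian smul" "F \<in> closed_complements smul E"
proof -
  show F: "F \<in> closed_complements smul E"
    using assms by (auto simp: grassmannian_def closed_complements_def complementary_sym)
  have EF: "E \<inter> F = {0}" "{x + y | x y. x \<in> E \<and> y \<in> F} = UNIV"
    using assms by (auto simp: closed_complements_def complementary_def)
  have "E \<noteq> UNIV" using EF assms by (auto simp: grassmannian_def)
  moreover have "E \<noteq> {0}" using EF assms by (auto simp: grassmannian_def)
  ultimately show "E \<in> grassmannian smul"
    using assms F by (auto simp: grassmannian_def closed_complements_def)
qed

lemma (in banach_space_over) openin_grassmann_topology:
  "openin (grassmann_topology smul) U \<longleftrightarrow> U \<subseteq> grassmannian smul \<and>
     (\<forall>F \<in> grassmannian smul. \<forall>E \<in> closed_complements smul F.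
        openin (op_topology smul E F) {T \<in> bounded_ops smul E F. graph_map E T \<in> U})"
proof -
  have *: "{T \<in> B. g T \<in> U \<inter> V} = {T \<in> B. g T \<in> U} \<inter> {T \<in> B. g T \<in> V}"
    "{T \<in> B. g T \<in> \<Union>\<K>} = (\<Union>V\<in>\<K>. {T \<in> B. g T \<in> V})"
    for B :: "('a \<Rightarrow> 'a) set" and g :: "_ \<Rightarrow> 'a set" and U V \<K>
    by auto
  show ?thesis
    unfolding grassmann_topology_def
    by (subst topology_inverse')
      (unfold istopology_def *, intro conjI allI impI, blast, blast, blast,
       intro ballI openin_Union, blast, rule refl)
qed

lemma (in banach_space_over) grassmann_topology_unique:
  assumes top: "topspace \<tau> = grassmannian smul"
    and C: "\<And>F. F \<in> grassmannian smul \<Longrightarrow> openin \<tau> (closed_complements smul F)"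
    and q: "\<And>E F. F \<in> grassmannian smul \<Longrightarrow> E \<in> closed_complements smul F \<Longrightarrow>
      homeomorphic_map (op_topology smul E F) (subtopology \<tau> (closed_complements smul F))
        (graph_map E)"
  shows "\<tau> = grassmann_topology smul"
proof (rule topology_eq[THEN iffD2], intro allI iffI)
  fix U assume U: "openin \<tau> U"
  have "openin (op_topology smul E F) {T \<in> bounded_ops smul E F. graph_map E T \<in> U}"
    if FE: "F \<in> grassmannian smul" "E \<in> closed_complements smul F" for E F
  proof -
    have "continuous_map (op_topology smul E F) \<tau> (graph_map E)"
      using homeomorphic_imp_continuous_map[OF q[OF FE]] by (simp add: continuous_map_in_subtopology)
    moreover have "topspace (op_topology smul E F) = bounded_ops smul E F"
      using FE by (intro topspace_op_topology) (simp add: closed_complements_def)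
    ultimately show ?thesis
      using openin_continuous_map_preimage[OF _ U] by force
  qed
  then show "openin (grassmann_topology smul) U"
    using openin_subset[OF U] top by (simp add: openin_grassmann_topology)
next
  fix U assume "openin (grassmann_topology smul) U"
  then have UG: "U \<subseteq> grassmannian smul" and
    U: "\<And>E F. F \<in> grassmannian smul \<Longrightarrow> E \<in> closed_complements smul F \<Longrightarrow>
      openin (op_topology smul E F) {T \<in> bounded_ops smul E F. graph_map E T \<in> U}"
    by (auto simp: openin_grassmann_topology)
  have "\<exists>V. openin \<tau> V \<and> E \<in> V \<and> V \<subseteq> U" if E: "E \<in> U" for E
  proof -
    obtain F where "F \<in> closed_complements smul E" using E UG by (auto simp: grassmannian_def)
    then have FE: "F \<in> grassmannian smul" "E \<in> closed_complements smul F"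
      using closed_complements_grassmannian E UG by blast+
    have ts: "topspace (op_topology smul E F) = bounded_ops smul E F"
      using FE by (intro topspace_op_topology) (simp add: closed_complements_def)
    have sur: "graph_map E ` bounded_ops smul E F = closed_complements smul F"
      using homeomorphic_imp_surjective_map[OF q[OF FE]] openin_subset[OF C[OF FE(1)]] ts
      by (auto simp: topspace_subtopology)
    have eq: "graph_map E ` {T \<in> bounded_ops smul E F. graph_map E T \<in> U} =
        U \<inter> closed_complements smul F"
      unfolding sur[symmetric] by auto
    have "openin (subtopology \<tau> (closed_complements smul F)) (U \<inter> closed_complements smul F)"
      using homeomorphic_imp_open_map[OF q[OF FE]] U[OF FE] unfolding open_map_def eq[symmetric]
      by blast
    then have "openin \<tau> (U \<inter> closed_complements smul F)"
      using C[OF FE(1)] openin_trans_full by blast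
    then show ?thesis using E FE by blast
  qed
  then show "openin \<tau> U" by (subst openin_subopen) blast
qed

text \<open>
  The type \<open>'a \<Rightarrow>\<^sub>L 'a\<close> consists of the real-linear bounded operators, so linearity
  over \<open>'k\<close> is required in addition; the operator norm does not depend on the scalar field.
\<close>

definition idempotents :: "('k::real_or_complex \<Rightarrow> 'a::banach \<Rightarrow> 'a) \<Rightarrow> ('a \<Rightarrow>\<^sub>L 'a) set" where
  "idempotents smul =
     {Q. Vector_Spaces.linear smul smul (blinfun_apply Q) \<and>
         Q \<noteq> 0 \<and> Q \<noteq> id_blinfun \<and> Q o\<^sub>L Q = Q}"

definition complementary_pairs ::
    "('k::real_or_complex \<Rightarrow> 'a::banach \<Rightarrow> 'a) \<Rightarrow> ('a set \<times> 'a set) set" where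
  "complementary_pairs smul =
     {(E, F). E \<in> grassmannian smul \<and> F \<in> grassmannian smul \<and> complementary E F}"

end

theory Submission
  imports Defs
begin

text \<open>
  The proof rests on viewing the Grassmannian as a quotient of the set of idempotents: a set \<open>U\<close>
  of subspaces is open iff \<open>{Q. range Q \<in> U}\<close> is open in the norm topology
  (\<open>openin_grassmann_topology_iff\<close>). After that, charts are never used again, and everything
  is algebra with idempotents.

  For one half of this criterion, if \<open>P\<close> projects onto \<open>E\<close> along \<open>F\<close>, then the
  graph of \<open>S\<close> in \<open>\<L>(E,F)\<close> is the range of the idempotent \<open>P + S P\<close>, which depends
  continuously on \<open>S\<close> (\<open>graph_idempotent\<close>). For the other half, and for all that
  follows, the main tool is \<open>nearby_idempotent_with_range\<close>: if \<open>R\<close> is close to \<open>Q\<close>, then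
  \<open>S = I + (R - Q) Q\<close> is close to \<open>I\<close>, hence invertible; it maps the range of \<open>Q\<close>
  onto that of \<open>R\<close> and fixes the kernel of \<open>Q\<close> pointwise. Conjugation by \<open>S\<close> therefore
  moves any idempotent with the range of \<open>Q\<close> slightly, to one with the range of \<open>R\<close>.
  Conjugating \<open>Q\<close> itself exhibits the range of \<open>R\<close> as the graph of a small operator, which
  is the continuity of \<open>Q \<mapsto> range Q\<close>; conjugating the other idempotents with the same
  range shows that this map is open. Since the kernel of \<open>Q\<close> is the range of
  \<open>I - Q\<close>, the same holds for \<open>Q \<mapsto> ker Q\<close>.

  Injectivity is algebra, and surjectivity is the boundedness of the projection attached to a
  pair of closed complements, a consequence of Baire's theorem (\<open>bounded_linear_projection\<close>).
  It remains to see that the inverse map is continuous. If \<open>E = range Q\<^sub>1\<close> and \<open>F = ker Q\<^sub>2\<close>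
  are complementary with \<open>Q\<^sub>1, Q\<^sub>2\<close> close to \<open>Q\<close>, then the projection \<open>P\<close> onto \<open>E\<close> along
  \<open>F\<close> satisfies \<open>P - Q\<^sub>1 = P (Q\<^sub>2 - Q\<^sub>1)\<close>, so it is close to \<open>Q\<close> too; and the set of
  such \<open>E\<close> and the set of such \<open>F\<close> are open, because the two maps are.
\<close>

section \<open>Bounded projections and operators near the identity\<close>

text \<open>
  This is the closed graph theorem for \<open>P\<close>, proved in the usual way: by Baire, the closure of
  some sublevel set of \<open>norm (P x)\<close> contains a ball, so up to an error of half its norm every
  \<open>x\<close> is a vector \<open>h x\<close> with \<open>norm (P (h x)) \<le> M * norm x\<close>. Iterating on the error
  writes \<open>x\<close> as a series on which \<open>P\<close> converges absolutely. Closedness of the range and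
  of the kernel replaces closedness of the graph.
\<close>

lemma bounded_linear_projection:
  fixes P :: "'a::banach \<Rightarrow> 'a"
  assumes lin: "linear P" and idem: "\<And>x. P (P x) = P x"
    and ran: "closed (range P)" and ker: "closed {x. P x = 0}"
  shows "bounded_linear P"
proof -
  define A where "A n = {x. norm (P x) \<le> real n}" for n :: nat
  have "\<exists>n. interior (closure (A n)) \<noteq> {}"
  proof (rule ccontr)
    assume "\<not> ?thesis"
    then have "euclidean interior_of \<Union>(range (\<lambda>n. closure (A n))) = {}"
      by (intro Baire_category_alt) (auto simp: completely_metrizable_space_euclidean)
    moreover have "\<Union>(range (\<lambda>n. closure (A n))) = UNIV"
    proof -
      have "x \<in> \<Union>(range (\<lambda>n. closure (A n)))" for x
      proof -
        obtain n where "norm (P x) \<le> real n" using real_arch_simple by blast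
        then have "x \<in> A n" by (simp add: A_def)
        then show ?thesis using closure_subset by blast
      qed
      then show ?thesis by blast
    qed
    ultimately show False by simp
  qed
  then obtain n x0 where "x0 \<in> interior (closure (A n))" by blast
  then obtain r where r: "r > 0" "cball x0 r \<subseteq> closure (A n)"
    using mem_interior_cball by blast
  define M where "M = 2 * real n / r"
  have M: "M \<ge> 0" using r by (simp add: M_def)
  have "\<exists>y. norm (x - y) \<le> norm x / 2 \<and> norm (P y) \<le> M * norm x" for x
  proof (cases "x = 0")
    case False
    define t where "t = r / norm x"
    have t: "t > 0" using False r by (simp add: t_def)
    \<comment> \<open>the error in \<open>u - v\<close> may be \<open>2 * d\<close>, which after division by \<open>t\<close> is half of \<open>norm x\<close>\<close>
    define d where "d = t * norm x / 4"
    have d: "d > 0" using t False by (simp add: d_def)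
    have "x0 + t *\<^sub>R x \<in> cball x0 r" "x0 \<in> cball x0 r"
      using r False by (auto simp: t_def dist_norm)
    then have "x0 + t *\<^sub>R x \<in> closure (A n)" "x0 \<in> closure (A n)" using r by blast+
    then obtain u v where uv: "u \<in> A n" "dist u (x0 + t *\<^sub>R x) < d" "v \<in> A n" "dist v x0 < d"
      unfolding closure_approachable using d by meson
    define y where "y = (u - v) /\<^sub>R t"
    have "norm (t *\<^sub>R x - (u - v)) = norm ((v - x0) - (u - (x0 + t *\<^sub>R x)))"
      by (simp add: algebra_simps)
    also have "\<dots> \<le> 2 * d"
      using uv norm_triangle_ineq4[of "v - x0" "u - (x0 + t *\<^sub>R x)"] by (simp add: dist_norm)
    finally have "norm (t *\<^sub>R x - (u - v)) \<le> t * norm x / 2" by (simp add: d_def)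
    moreover have "t *\<^sub>R x - (u - v) = t *\<^sub>R (x - y)" using t by (simp add: y_def algebra_simps)
    ultimately have 1: "norm (x - y) \<le> norm x / 2" using t by simp
    have "norm (P (u - v)) \<le> 2 * real n"
      using uv norm_triangle_ineq4[of "P u" "P v"] by (simp add: A_def linear_diff[OF lin])
    moreover have "P y = P (u - v) /\<^sub>R t" by (simp add: y_def linear_scale[OF lin])
    ultimately have "norm (P y) \<le> 2 * real n / t"
      using t by (simp add: field_simps)
    also have "\<dots> = M * norm x" by (simp add: M_def t_def)
    finally show ?thesis using 1 by blast
  qed (auto simp: linear_0[OF lin] intro: exI[of _ 0])
  then obtain h where h: "\<And>x. norm (x - h x) \<le> norm x / 2" "\<And>x. norm (P (h x)) \<le> M * norm x"
    by metis
  have bound: "norm (P x) \<le> norm x * (2 * M)" for x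
  proof -
    define r where "r k = ((\<lambda>x. x - h x) ^^ k) x" for k
    have r_Suc: "r (Suc k) = r k - h (r k)" for k by (simp add: r_def)
    have r_le: "norm (r k) \<le> norm x * (1/2) ^ k" for k
    proof (induction k)
      case (Suc k)
      then show ?case using h(1)[of "r k"] by (simp add: r_Suc)
    qed (simp add: r_def)
    have "(\<lambda>k. norm x * (1/2) ^ k) \<longlonglongrightarrow> norm x * 0"
      by (intro tendsto_intros LIMSEQ_realpow_zero) auto
    then have "r \<longlonglongrightarrow> 0"
      using r_le by (intro Lim_null_comparison[of r]) (auto intro!: always_eventually)
    then have u: "(\<lambda>k. x - r k) \<longlonglongrightarrow> x"
      using tendsto_diff[OF tendsto_const[of x]] by fastforce
    have le: "norm (P (h (r k))) \<le> M * norm x * (1/2) ^ k" for k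
      using h(2)[of "r k"] mult_left_mono[OF r_le M, of k] by (simp add: mult.assoc)
    have sm: "summable (\<lambda>k. M * norm x * (1/2::real) ^ k)"
      by (intro summable_mult summable_geometric) auto
    define e where "e = (\<Sum>k. P (h (r k)))"
    have summ: "summable (\<lambda>k. P (h (r k)))"
      using le by (intro summable_comparison_test'[OF sm]) auto
    have "norm e \<le> (\<Sum>k. M * norm x * (1/2::real) ^ k)"
      unfolding e_def using le by (intro norm_suminf_le sm)
    also have "\<dots> = norm x * (2 * M)"
      by (subst suminf_mult) (auto simp: suminf_geometric)
    finally have e_le: "norm e \<le> norm x * (2 * M)" .
    have "(\<Sum>k<m. P (h (r k))) = P (x - r m)" for m
    proof (induction m)
      case 0
      then show ?case by (simp add: r_def linear_0[OF lin])
    next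
      case (Suc m)
      then show ?case by (simp add: r_Suc linear_diff[OF lin])
    qed
    then have Pu: "(\<lambda>k. P (x - r k)) \<longlonglongrightarrow> e"
      using summable_LIMSEQ[OF summ] by (simp add: e_def)
    \<comment> \<open>the limits of the two components of \<open>x - r k\<close> lie in the range and in the kernel, so they
      are the components of \<open>x\<close>\<close>
    have "e \<in> range P" using closed_sequentially[OF ran _ Pu] by blast
    then have Pe: "P e = e" using idem by auto
    have "(\<lambda>k. (x - r k) - P (x - r k)) \<longlonglongrightarrow> x - e"
      by (intro tendsto_diff u Pu)
    then have "x - e \<in> {x. P x = 0}"
      by (rule closed_sequentially[OF ker, rotated]) (simp add: linear_diff[OF lin] idem)
    then have "P x = e" by (simp add: linear_diff[OF lin] Pe)
    then show ?thesis using e_le by simp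
  qed
  show ?thesis
    using lin bound by (auto simp: bounded_linear_def bounded_linear_axioms_def)
qed

text \<open>
  The equation \<open>A x = y\<close> says that \<open>x\<close> is a fixed point of the contraction
  \<open>x \<mapsto> y + x - A x\<close>; this replaces the Neumann series.
\<close>

lemma near_identity_invertible:
  fixes A :: "'a::banach \<Rightarrow>\<^sub>L 'a"
  assumes A: "norm (A - id_blinfun) \<le> 1/2"
  obtains B where "A o\<^sub>L B = id_blinfun" "B o\<^sub>L A = id_blinfun" "norm B \<le> 2"
proof -
  have near: "norm (A x - x) \<le> 1/2 * norm x" for x
  proof -
    have "norm ((A - id_blinfun) x) \<le> norm (A - id_blinfun) * norm x" by (rule norm_blinfun)
    also have "\<dots> \<le> 1/2 * norm x" using A by (intro mult_right_mono) auto
    finally show ?thesis by (simp add: blinfun.diff_left)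
  qed
  have low: "norm x \<le> norm (A x) * 2" for x
    using near[of x] norm_triangle_ineq2[of x "A x"] by (simp add: norm_minus_commute)
  have "\<exists>x. A x = y" for y
  proof -
    have "\<exists>!x. y + x - A x = x"
    proof (rule banach_fix_type[of "1/2"], simp_all, intro allI)
      fix x z
      have "y + x - A x - (y + z - A z) = - (A (x - z) - (x - z))" by (simp add: blinfun.diff_right)
      then show "dist (y + x - A x) (y + z - A z) * 2 \<le> dist x z"
        using near[of "x - z"] by (simp only: dist_norm norm_minus_cancel)
    qed
    then show ?thesis by (auto simp: algebra_simps)
  qed
  then obtain g where Ag: "\<And>y. A (g y) = y" by metis
  have inj: "x = z" if "A x = A z" for x z
    using low[of "x - z"] that by (simp add: blinfun.diff_right)
  have "bounded_linear g"
  proof (rule bounded_linear_intro[of _ 2])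
    show "g (x + y) = g x + g y" for x y by (rule inj) (simp add: Ag blinfun.add_right)
    show "g (r *\<^sub>R x) = r *\<^sub>R g x" for r x by (rule inj) (simp add: Ag blinfun.scaleR_right)
    show "norm (g x) \<le> norm x * 2" for x using low[of "g x"] by (simp add: Ag)
  qed
  then have B: "blinfun_apply (Blinfun g) = g" by (rule bounded_linear_Blinfun_apply)
  show ?thesis
  proof
    show "A o\<^sub>L Blinfun g = id_blinfun" by (rule blinfun_eqI) (simp add: B Ag)
    show "Blinfun g o\<^sub>L A = id_blinfun" by (rule blinfun_eqI) (simp add: B inj Ag)
    show "norm (Blinfun g) \<le> 2"
      using low[of "g _"] by (intro norm_blinfun_bound) (auto simp: B Ag mult.commute)
  qed
qed

context banach_space_over
begin

section \<open>Idempotents and complementary pairs\<close>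

lemma linear_blinfun_iff:
  "Vector_Spaces.linear smul smul (blinfun_apply Q) \<longleftrightarrow> (\<forall>c x. Q (smul c x) = smul c (Q x))"
  by (simp add: Vector_Spaces.linear_iff blinfun.add_right vector_space_axioms)

lemma idempotents_iff:
  "Q \<in> idempotents smul \<longleftrightarrow>
     (\<forall>c x. Q (smul c x) = smul c (Q x)) \<and> Q \<noteq> 0 \<and> Q \<noteq> id_blinfun \<and> (\<forall>x. Q (Q x) = Q x)"
  unfolding idempotents_def linear_blinfun_iff
  by (auto simp: blinfun_apply_inject[symmetric] fun_eq_iff)

lemma complement_in_idempotents:
  assumes "Q \<in> idempotents smul"
  shows "id_blinfun - Q \<in> idempotents smul"
proof -
  have "Q = 0" if "id_blinfun - Q = id_blinfun" using that by simp
  then show ?thesis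
    using assms by (auto simp: idempotents_iff blinfun.diff_left blinfun.diff_right scale_right_diff_distrib)
qed

lemma range_idempotent:
  assumes "Q \<in> idempotents smul"
  shows "range Q = {x. Q x = x}"
proof -
  have "Q (Q x) = Q x" for x using assms by (simp add: idempotents_iff)
  moreover have "x \<in> range Q" if "Q x = x" for x by (rule range_eqI[of _ _ x]) (simp add: that)
  ultimately show ?thesis by blast
qed

lemma kernel_idempotent:
  assumes "Q \<in> idempotents smul"
  shows "{x. Q x = 0} = range (id_blinfun - Q)"
  unfolding range_idempotent[OF complement_in_idempotents[OF assms]] by (auto simp: blinfun.diff_left)

lemma closed_subspace_kernel:
  assumes "Q \<in> idempotents smul"
  shows "closed_subspace smul {x. Q x = 0}"
proof -
  have "closed {x. Q x = 0}"
    by (rule closed_Collect_eq) (rule continuous_intros)+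
  then show ?thesis
    using assms by (auto simp: closed_subspace_def idempotents_iff blinfun.add_right intro!: subspaceI)
qed

lemma closed_subspace_range:
  assumes "Q \<in> idempotents smul"
  shows "closed_subspace smul (range Q)"
proof -
  have "range Q = {x. (id_blinfun - Q) x = 0}"
    unfolding range_idempotent[OF assms] by (auto simp: blinfun.diff_left)
  then show ?thesis
    using closed_subspace_kernel[OF complement_in_idempotents[OF assms]] by simp
qed

lemma complementary_range_kernel:
  assumes Q: "Q \<in> idempotents smul"
  shows "complementary (range Q) {x. Q x = 0}"
  unfolding complementary_def
proof
  show "range Q \<inter> {x. Q x = 0} = {0}"
    using range_idempotent[OF Q] by auto
  have "\<exists>y z. x = y + z \<and> y \<in> range Q \<and> z \<in> {x. Q x = 0}" for x
    using Q by (intro exI[of _ "Q x"] exI[of _ "x - Q x"]) (auto simp: idempotents_iff blinfun.diff_right)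
  then show "{x + y |x y. x \<in> range Q \<and> y \<in> {x. Q x = 0}} = UNIV"
    by blast
qed

lemma range_kernel_complementary_pair:
  assumes Q: "Q \<in> idempotents smul"
  shows "(range Q, {x. Q x = 0}) \<in> complementary_pairs smul"
proof -
  have "range Q \<noteq> {0}"
  proof
    assume "range Q = {0}"
    then have "Q = 0" by (intro blinfun_eqI) (metis rangeI singletonD zero_blinfun.rep_eq)
    then show False using Q by (simp add: idempotents_iff)
  qed
  moreover have "range Q \<noteq> UNIV"
  proof
    assume "range Q = UNIV"
    then have "Q = id_blinfun"
      unfolding range_idempotent[OF Q] by (intro blinfun_eqI) auto
    then show False using Q by (simp add: idempotents_iff)
  qed
  moreover have "{x. Q x = 0} \<in> closed_complements smul (range Q)"
    using closed_subspace_kernel[OF Q] complementary_range_kernel[OF Q]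
    by (simp add: closed_complements_def complementary_sym)
  ultimately have "range Q \<in> grassmannian smul"
    using closed_subspace_range[OF Q] by (auto simp: grassmannian_def)
  then show ?thesis
    using closed_complements_grassmannian(1) \<open>{x. Q x = 0} \<in> _\<close> complementary_range_kernel[OF Q]
    by (auto simp: complementary_pairs_def)
qed

lemma range_kernel_grassmannian:
  assumes Q: "Q \<in> idempotents smul"
  shows "range Q \<in> grassmannian smul" "{x. Q x = 0} \<in> grassmannian smul"
    "range Q \<in> closed_complements smul {x. Q x = 0}"
  using range_kernel_complementary_pair[OF Q] closed_subspace_range[OF Q]
  by (auto simp: complementary_pairs_def closed_complements_def)

lemma idempotent_eqI:
  assumes Q: "Q \<in> idempotents smul" and R: "R \<in> idempotents smul"
    and "range Q = range R" and "{x. Q x = 0} = {x. R x = 0}"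
  shows "Q = R"
proof (rule blinfun_eqI)
  fix x
  have "x - Q x \<in> {x. Q x = 0}"
    using Q by (simp add: idempotents_iff blinfun.diff_right)
  then have "R (x - Q x) = 0" unfolding assms(4) by simp
  moreover have "Q x \<in> range R" unfolding assms(3)[symmetric] by (rule rangeI)
  then have "R (Q x) = Q x" unfolding range_idempotent[OF R] by simp
  ultimately show "Q x = R x" by (simp add: blinfun.diff_right)
qed

lemma exists_idempotent:
  assumes "(E, F) \<in> complementary_pairs smul"
  obtains Q where "Q \<in> idempotents smul" "range Q = E" "{x. Q x = 0} = F"
proof -
  have sub: "subspace E" "closed E" "subspace F" "closed F"
    and ne: "E \<noteq> {0}" "F \<noteq> {0}"
    and EF: "E \<inter> F = {0}" "{x + y |x y. x \<in> E \<and> y \<in> F} = UNIV"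
    using assms
    by (auto simp: complementary_pairs_def grassmannian_def closed_subspace_def complementary_def)
  have "\<exists>e. e \<in> E \<and> x - e \<in> F" for x
  proof -
    have "x \<in> {x + y |x y. x \<in> E \<and> y \<in> F}" using EF(2) by simp
    then show ?thesis by force
  qed
  then obtain P where P: "\<And>x. P x \<in> E" "\<And>x. x - P x \<in> F" by metis
  have eqI: "P x = e" if "e \<in> E" "x - e \<in> F" for x e
  proof -
    have "P x - e \<in> E" using subspace_diff[OF sub(1) P(1) that(1)] .
    moreover have "(x - e) - (x - P x) \<in> F" using subspace_diff[OF sub(3) that(2) P(2)] .
    ultimately show ?thesis using EF(1) by force
  qed
  have add: "P (x + y) = P x + P y" for x y
  proof (rule eqI)
    show "P x + P y \<in> E" using P sub by (intro subspace_add)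
    have "(x - P x) + (y - P y) \<in> F" using subspace_add[OF sub(3) P(2) P(2)] .
    then show "x + y - (P x + P y) \<in> F" by (simp add: algebra_simps)
  qed
  have scale: "P (smul c x) = smul c (P x)" for c x
  proof (rule eqI)
    show "smul c (P x) \<in> E" using P sub by (intro subspace_scale)
    have "smul c (x - P x) \<in> F" using P sub by (intro subspace_scale)
    then show "smul c x - smul c (P x) \<in> F" by (simp add: scale_right_diff_distrib)
  qed
  have lin: "linear P"
    by (rule linearI) (simp_all only: add scale scale_of_real[symmetric])
  have fixE: "P x = x" if "x \<in> E" for x
    using that sub by (intro eqI) (auto simp: subspace_0)
  have "x \<in> range P" if "x \<in> E" for x by (rule range_eqI[of _ _ x]) (simp add: that fixE)
  then have ran: "range P = E" using P by blast
  have ker: "{x. P x = 0} = F"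
  proof -
    have "P x = 0" if "x \<in> F" for x using that sub by (intro eqI) (auto simp: subspace_0)
    moreover have "x \<in> F" if "P x = 0" for x using P(2)[of x] that by simp
    ultimately show ?thesis by blast
  qed
  have "bounded_linear P"
    using sub P fixE by (intro bounded_linear_projection lin) (auto simp: ran ker)
  then have Q: "blinfun_apply (Blinfun P) = P" by (rule bounded_linear_Blinfun_apply)
  have "Blinfun P \<noteq> 0"
  proof
    assume "Blinfun P = 0"
    then have "P = (\<lambda>x. 0)" using Q by (metis zero_blinfun.rep_eq)
    then show False using ran ne by auto
  qed
  moreover have "Blinfun P \<noteq> id_blinfun"
  proof
    assume "Blinfun P = id_blinfun"
    then have "P = (\<lambda>x. x)" using Q by (metis id_blinfun.rep_eq)
    then show False using ker ne by auto
  qed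
  ultimately have "Blinfun P \<in> idempotents smul"
    by (simp add: idempotents_iff Q scale fixE P)
  then show ?thesis using that by (simp add: Q ran ker)
qed

section \<open>Moving the range of an idempotent\<close>

text \<open>
  The range of \<open>Q\<close> is carried to that of \<open>R\<close> by an operator near the identity, and conjugating
  \<open>Q'\<close> by this operator gives \<open>R'\<close>. With \<open>Q' = Q\<close> the kernel stays fixed, which shows that the
  range of \<open>R\<close> lies in the chart of the complement \<open>ker Q\<close>; with \<open>Q' \<noteq> Q\<close> the lemma
  expresses that \<open>Q \<mapsto> range Q\<close> is an open map.
\<close>

lemma nearby_idempotent_with_range:
  assumes Q: "Q \<in> idempotents smul" and Q': "Q' \<in> idempotents smul"
    and ran: "range Q' = range Q" and e: "e > 0"
  obtains d where "d > 0"
    "\<And>R. R \<in> idempotents smul \<Longrightarrow> dist R Q < d \<Longrightarrow>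
       \<exists>R' \<in> idempotents smul. range (blinfun_apply R') = range R \<and> dist R' Q' < e \<and>
         ({x. Q' x = 0} = {x. Q x = 0} \<longrightarrow> {x. blinfun_apply R' x = 0} = {x. Q x = 0})"
proof -
  define m where "m = norm Q + 1"
  define m' where "m' = norm Q' + 1"
  have m: "norm Q \<le> m" "m \<ge> 1" "norm Q' < m'" "m' > 0"
    by (auto simp: m_def m'_def add_nonneg_pos)
  \<comment> \<open>the first bound makes the operators \<open>S\<close> and \<open>A\<close> below invertible, the second makes the
    conjugate of \<open>Q'\<close> by \<open>S\<close> differ from \<open>Q'\<close> by less than \<open>e\<close>\<close>
  define d where "d = min (1 / (2 * m)) (e / (4 * m * m'))"
  have d: "d > 0" using m e by (simp add: d_def)
  have "\<exists>R' \<in> idempotents smul. range (blinfun_apply R') = range R \<and> dist R' Q' < e \<and>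
         ({x. Q' x = 0} = {x. Q x = 0} \<longrightarrow> {x. blinfun_apply R' x = 0} = {x. Q x = 0})"
    if R: "R \<in> idempotents smul" and RQ: "dist R Q < d" for R
  proof -
    have Ql: "Q (smul c x) = smul c (Q x)" "Q (Q x) = Q x" for c x using Q by (auto simp: idempotents_iff)
    have Rl: "R (smul c x) = smul c (R x)" "R (R x) = R x" for c x using R by (auto simp: idempotents_iff)
    have Q'l: "Q' (smul c x) = smul c (Q' x)" "Q' (Q' x) = Q' x" for c x using Q' by (auto simp: idempotents_iff)
    define S where "S = id_blinfun + ((R - Q) o\<^sub>L Q)"
    have S: "S x = x + R (Q x) - Q x" for x
      by (simp add: S_def blinfun.bilinear_simps Ql)
    have "norm (S - id_blinfun) \<le> norm (R - Q) * norm Q"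
      by (simp add: S_def norm_blinfun_compose)
    also have "\<dots> \<le> d * m"
      using RQ m d by (intro mult_mono) (auto simp: dist_norm)
    finally have Sd: "norm (S - id_blinfun) \<le> d * m" .
    have "d * m \<le> 1 / (2 * m) * m" using m by (intro mult_right_mono) (auto simp: d_def)
    then have dm: "d * m \<le> 1/2" using m by simp
    have "d * m \<le> e / (4 * m * m') * m" using m by (intro mult_right_mono) (auto simp: d_def)
    also have "\<dots> = e / (4 * m')" using m by simp
    finally have dm': "d * m * (4 * m') \<le> e" using m by (simp add: field_simps)
    obtain S' where S': "S o\<^sub>L S' = id_blinfun" "S' o\<^sub>L S = id_blinfun" "norm S' \<le> 2"
      using near_identity_invertible[of S] Sd dm by auto
    have SS': "S (S' x) = x" for x using arg_cong[OF S'(1), of "\<lambda>T. blinfun_apply T x"] by simp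
    have S'S: "S' (S x) = x" for x using arg_cong[OF S'(2), of "\<lambda>T. blinfun_apply T x"] by simp
    have Sl: "S (smul c x) = smul c (S x)" for c x
      by (simp add: S Ql Rl scale_right_distrib scale_right_diff_distrib)
    have S'l: "S' (smul c x) = smul c (S' x)" for c x
      using S'S[of "smul c (S' x)"] by (simp add: Sl SS')
    have d1: "d \<le> 1/2" 
      using order_trans[OF mult_left_mono[OF m(2), of d] dm] d by simp
    \<comment> \<open>\<open>S\<close> maps \<open>range Q\<close> to \<open>R (range Q)\<close>; that this is all of \<open>range R\<close> follows from
      \<open>R A = R Q\<close> for the surjective operator \<open>A = I + Q - R\<close>\<close>
    define A where "A = id_blinfun + (Q - R)"
    have "norm (A - id_blinfun) \<le> 1/2"
      using RQ d1 by (simp add: A_def dist_norm norm_minus_commute)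
    then obtain A' where A': "A o\<^sub>L A' = id_blinfun" by (rule near_identity_invertible)
    have AA': "A (A' x) = x" for x using arg_cong[OF A', of "\<lambda>T. blinfun_apply T x"] by simp
    have RA: "R (A x) = R (Q x)" for x
      by (simp add: A_def blinfun.bilinear_simps Rl)
    have S_ran: "S ` range Q = range R"
    proof
      show "S ` range Q \<subseteq> range R" by (auto simp: S Ql)
      show "range R \<subseteq> S ` range Q"
      proof
        fix y assume "y \<in> range R"
        then obtain x where "y = R x" by blast
        then have "y = R (Q (A' x))" using RA[of "A' x"] by (simp add: AA')
        also have "\<dots> = S (Q (A' x))" by (simp add: S Ql)
        finally show "y \<in> S ` range Q" by blast
      qed
    qed
    define R' where "R' = S o\<^sub>L Q' o\<^sub>L S'"
    have R'a: "R' x = S (Q' (S' x))" for x by (simp add: R'_def)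
    have "range S' = UNIV" using S'S by (metis surjI)
    then have "range R' = S ` range Q'"
      unfolding R'a using image_image[of "\<lambda>x. S (Q' x)" S' UNIV] image_image[of S Q' UNIV] by simp
    then have ranR': "range R' = range R" using S_ran ran by simp
    have inj: "S x = S y \<longleftrightarrow> x = y" for x y using S'S by metis
    have "R' \<noteq> 0"
      using ranR' range_kernel_grassmannian(1)[OF R] by (auto simp: grassmannian_def)
    moreover have "R' \<noteq> id_blinfun"
      using ranR' range_kernel_grassmannian(1)[OF R] by (auto simp: grassmannian_def)
    ultimately have R': "R' \<in> idempotents smul"
      by (simp add: idempotents_iff R'a Sl S'l Q'l S'S)
    have S0: "S x = 0 \<longleftrightarrow> x = 0" for x using inj[of x 0] by simp
    have ker: "{x. R' x = 0} = {x. Q x = 0}" if k: "{x. Q' x = 0} = {x. Q x = 0}"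
    proof -
      have "Q (S' x) = 0 \<longleftrightarrow> Q x = 0" for x
      proof
        assume "Q (S' x) = 0"
        then have "S (S' x) = S' x" by (simp add: S)
        then show "Q x = 0" using \<open>Q (S' x) = 0\<close> by (simp add: SS')
      next
        assume x: "Q x = 0"
        then have "S x = x" by (simp add: S)
        then have "S' x = x" using S'S[of x] by simp
        then show "Q (S' x) = 0" using x by simp
      qed
      then show ?thesis using k by (auto simp: R'a S0 set_eq_iff)
    qed
    have "R' - Q' = (((S - id_blinfun) o\<^sub>L Q') - (Q' o\<^sub>L (S - id_blinfun))) o\<^sub>L S'"
      by (rule blinfun_eqI) (simp add: R'a blinfun.bilinear_simps SS')
    then have "norm (R' - Q') \<le> norm (((S - id_blinfun) o\<^sub>L Q') - (Q' o\<^sub>L (S - id_blinfun))) * norm S'"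
      by (simp add: norm_blinfun_compose)
    also have "\<dots> \<le> (norm (S - id_blinfun) * norm Q' + norm Q' * norm (S - id_blinfun)) * 2"
      using S'(3) by (intro mult_mono order_trans[OF norm_triangle_ineq4] add_mono norm_blinfun_compose) auto
    also have "\<dots> = norm (S - id_blinfun) * (4 * norm Q')" by simp
    also have "\<dots> \<le> d * m * (4 * norm Q')" using Sd by (intro mult_right_mono) auto
    also have "\<dots> < d * m * (4 * m')" using m d by (intro mult_strict_left_mono) auto
    finally have "dist R' Q' < e" using dm' by (simp add: dist_norm)
    then show ?thesis using R' ranR' ker by blast
  qed
  then show ?thesis using that d by blast
qed

section \<open>The Grassmann topology as a quotient of the idempotents\<close>

lemma openin_idempotents_iff:
  "openin (top_of_set (idempotents smul)) N \<longleftrightarrow> N \<subseteq> idempotents smul \<and>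
     (\<forall>Q\<in>N. \<exists>e>0. \<forall>R\<in>idempotents smul. dist R Q < e \<longrightarrow> R \<in> N)"
  by (rule openin_euclidean_subtopology_iff)

lemma openin_idempotentsE:
  assumes "openin (top_of_set (idempotents smul)) N" "Q \<in> N"
  obtains e where "e > 0" "\<And>R. R \<in> idempotents smul \<Longrightarrow> dist R Q < e \<Longrightarrow> R \<in> N"
  using assms unfolding openin_idempotents_iff by blast

text \<open>
  The supremum defining the distance runs over the unit ball only; homogeneity gives the
  operator norm inequality at every point.
\<close>

lemma norm_diff_le_op_dist:
  assumes E: "subspace E" and m: "S \<in> bounded_ops smul E F" "T \<in> bounded_ops smul E F"
    and x: "x \<in> E"
  shows "norm (S x - T x) \<le> op_dist smul E F S T * norm x"
proof (cases "x = 0")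
  case False
  define r where "r = inverse (norm x)"
  have r: "r > 0" using False by (simp add: r_def)
  have y: "smul (of_real r) x \<in> E" using E x by (rule subspace_scale)
  have "norm (smul (of_real r) x) \<le> 1"
    using False by (simp only: scale_of_real r_def norm_scaleR) simp
  then have "norm (S (smul (of_real r) x) - T (smul (of_real r) x)) \<le> op_dist smul E F S T"
    by (rule norm_le_op_dist[OF m y])
  moreover have "S (smul (of_real r) x) - T (smul (of_real r) x) = r *\<^sub>R (S x - T x)"
    using m x by (simp add: bounded_ops_def scale_right_diff_distrib flip: scale_of_real)
  ultimately have "r * norm (S x - T x) \<le> op_dist smul E F S T"
    using r by simp
  then show ?thesis using False by (simp add: r_def field_simps)
next
  case True
  have "S 0 = 0" "T 0 = 0"
    using m x True by (auto simp: bounded_ops_def)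
  then show ?thesis using True by simp
qed

text \<open>
  Continuity of \<open>Q \<mapsto> range Q\<close>. In the chart of \<open>E = range Q\<close> along \<open>F = ker Q\<close>, the subspace
  \<open>E\<close> is the graph of the zero operator. If \<open>R\<close> is near \<open>Q\<close> and \<open>R'\<close> is an idempotent near
  \<open>Q\<close> with the range of \<open>R\<close> and the kernel of \<open>Q\<close>, then the range of \<open>R\<close> is the graph of
  \<open>R' - I\<close> on \<open>E\<close>, and there \<open>R' - I = R' - Q\<close> is small.
\<close>

lemma openin_range_vimage:
  assumes U: "openin (grassmann_topology smul) U"
  shows "openin (top_of_set (idempotents smul)) {Q \<in> idempotents smul. range Q \<in> U}"
  unfolding openin_idempotents_iff
proof (intro conjI ballI)
  fix Q assume "Q \<in> {Q \<in> idempotents smul. range Q \<in> U}"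
  then have Q: "Q \<in> idempotents smul" and QU: "range Q \<in> U" by auto
  define E where "E = range Q"
  define F where "F = {x. Q x = 0}"
  define Z where "Z = (\<lambda>x\<in>E. 0::'a)"
  define V where "V = {T \<in> bounded_ops smul E F. graph_map E T \<in> U}"
  have E: "closed_subspace smul E" unfolding E_def by (rule closed_subspace_range[OF Q])
  then have subE: "subspace E" by (simp add: closed_subspace_def)
  interpret M: Metric_space "bounded_ops smul E F" "op_dist smul E F"
    by (rule Metric_space_bounded_ops[OF E])
  have V: "openin M.mtopology V"
    using U range_kernel_grassmannian[OF Q]
    unfolding openin_grassmann_topology V_def E_def F_def op_topology_def by blast
  have "Z \<in> bounded_ops smul E F"
    using subspace_add[OF subE] subspace_scale[OF subE]
    by (auto simp: bounded_ops_def Z_def F_def intro!: exI[of _ 0])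
  moreover have "graph_map E Z = E"
    by (auto simp: graph_map_def Z_def)
  ultimately have "Z \<in> V" using QU by (simp add: V_def E_def)
  then obtain r where r: "r > 0" "M.mball Z r \<subseteq> V"
    using V unfolding M.openin_mtopology by blast
  obtain d where d: "d > 0" "\<And>R. R \<in> idempotents smul \<Longrightarrow> dist R Q < d \<Longrightarrow>
       \<exists>R' \<in> idempotents smul. range (blinfun_apply R') = range R \<and> dist R' Q < r / 2 \<and>
         {x. blinfun_apply R' x = 0} = {x. Q x = 0}"
    using nearby_idempotent_with_range[OF Q Q refl, of "r / 2"] r by auto
  have "R \<in> {Q \<in> idempotents smul. range Q \<in> U}"
    if R: "R \<in> idempotents smul" "dist R Q < d" for R
  proof -
    obtain R' where R': "R' \<in> idempotents smul" "range R' = range R" "dist R' Q < r / 2"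
      "{x. R' x = 0} = {x. Q x = 0}"
      using d(2)[OF R] by blast
    have ker: "R' x = 0 \<longleftrightarrow> Q x = 0" for x using R'(4) by blast
    have R'l: "R' (smul c x) = smul c (R' x)" "R' (R' x) = R' x" for c x
      using R'(1) by (auto simp: idempotents_iff)
    have fixE: "Q x = x" if "x \<in> E" for x using that range_idempotent[OF Q] by (simp add: E_def)
    define T where "T = (\<lambda>x\<in>E. R' x - x)"
    have Tn: "norm (T x) \<le> norm (R' - Q) * norm x" if "x \<in> E" for x
      using norm_blinfun[of "R' - Q" x] that fixE[OF that] by (simp add: T_def blinfun.diff_left)
    have T: "T \<in> bounded_ops smul E F"
    proof -
      have "R' (R' x - x) = 0" for x by (simp add: blinfun.diff_right R'l)
      then have "T \<in> E \<rightarrow>\<^sub>E F" by (auto simp: T_def F_def ker[symmetric])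
      moreover have "\<forall>x\<in>E. \<forall>y\<in>E. T (x + y) = T x + T y"
        using subspace_add[OF subE] by (simp add: T_def blinfun.add_right)
      moreover have "\<forall>c. \<forall>x\<in>E. T (smul c x) = smul c (T x)"
        using subspace_scale[OF subE] by (simp add: T_def R'l scale_right_diff_distrib)
      moreover have "\<exists>C. \<forall>x\<in>E. norm (T x) \<le> C * norm x" using Tn by blast
      ultimately show ?thesis by (simp add: bounded_ops_def)
    qed
    have "op_dist smul E F Z T \<le> norm (R' - Q)"
    proof -
      have "norm (Z x - T x) \<le> norm (R' - Q)" if "x \<in> E" "norm x \<le> 1" for x
        using Tn[OF that(1)] mult_left_mono[OF that(2), of "norm (R' - Q)"] that(1)
        by (simp add: Z_def)
      moreover have "{x \<in> E. norm x \<le> 1} \<noteq> {}"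
        using subspace_0[OF subE] by (auto intro!: exI[of _ 0])
      ultimately have "op_norm E (\<lambda>x. Z x - T x) \<le> norm (R' - Q)"
        unfolding op_norm_def by (intro cSUP_least) auto
      then show ?thesis using T \<open>Z \<in> bounded_ops smul E F\<close> by (simp add: op_dist_def)
    qed
    then have "T \<in> M.mball Z r"
      using R'(3) r T \<open>Z \<in> bounded_ops smul E F\<close> by (simp add: dist_norm)
    then have "graph_map E T \<in> U" using r by (auto simp: V_def)
    moreover have "graph_map E T = R' ` E"
      unfolding graph_map_def by (rule image_cong) (auto simp: T_def)
    moreover have "R' ` E = range R'"
    proof -
      have "R' x = R' (Q x)" for x
      proof -
        have "Q (x - Q x) = 0" using Q by (simp add: idempotents_iff blinfun.diff_right)
        then have "R' (x - Q x) = 0" by (simp only: ker)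
        then show ?thesis by (simp add: blinfun.diff_right)
      qed
      then show ?thesis by (auto simp: E_def)
    qed
    ultimately show ?thesis using R R'(2) by simp
  qed
  then show "\<exists>e>0. \<forall>R\<in>idempotents smul. dist R Q < e \<longrightarrow> R \<in> {Q \<in> idempotents smul. range Q \<in> U}"
    using d(1) by blast
qed auto

text \<open>
  The idempotent \<open>P + S P\<close> is the projection onto the graph of \<open>S\<close> along \<open>F\<close>. It lifts the
  chart parametrization continuously from subspaces to idempotents.
\<close>

lemma graph_idempotent:
  assumes P: "P \<in> idempotents smul" "range P = E" "{x. P x = 0} = F"
    and S: "S \<in> bounded_ops smul E F"
  obtains R where "R \<in> idempotents smul" "range R = graph_map E S" "\<And>x. R x = P x + S (P x)"
proof -
  have Pl: "P (smul c x) = smul c (P x)" "P (P x) = P x" for c x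
    using P(1) by (auto simp: idempotents_iff)
  have PE: "P x \<in> E" for x using P(2) by blast
  have SF: "P (S x) = 0" if "x \<in> E" for x using S that P(3) by (auto simp: bounded_ops_def)
  have Sa: "S (x + y) = S x + S y" "S (smul c x) = smul c (S x)" if "x \<in> E" "y \<in> E" for x y c
    using S that by (auto simp: bounded_ops_def)
  obtain C where C: "\<And>x. x \<in> E \<Longrightarrow> norm (S x) \<le> C * norm x"
    using S unfolding bounded_ops_def by blast
  have "bounded_linear (\<lambda>x. S (P x))"
  proof (rule bounded_linear_intro[of _ "\<bar>C\<bar> * norm P"])
    show "S (P (x + y)) = S (P x) + S (P y)" for x y by (simp add: blinfun.add_right Sa PE)
    show "S (P (r *\<^sub>R x)) = r *\<^sub>R S (P x)" for r x
      unfolding scale_of_real[symmetric] Pl by (rule Sa(2)[OF PE PE])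
    fix x
    have "norm (S (P x)) \<le> C * norm (P x)" by (rule C[OF PE])
    also have "\<dots> \<le> \<bar>C\<bar> * (norm P * norm x)"
      by (intro mult_mono norm_blinfun) auto
    finally show "norm (S (P x)) \<le> norm x * (\<bar>C\<bar> * norm P)" by (simp add: algebra_simps)
  qed
  then have "bounded_linear (\<lambda>x. P x + S (P x))"
    by (intro bounded_linear_add blinfun.bounded_linear_right)
  then have R: "Blinfun (\<lambda>x. P x + S (P x)) x = P x + S (P x)" for x
    by (simp add: bounded_linear_Blinfun_apply)
  define R where "R = Blinfun (\<lambda>x. P x + S (P x))"
  have R: "R x = P x + S (P x)" for x unfolding R_def by (rule R)
  have PR: "P (R x) = P x" for x by (simp add: R blinfun.add_right Pl SF PE)
  have "R \<noteq> 0"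
  proof
    assume "R = 0"
    then have "P = 0" using PR by (intro blinfun_eqI) (metis blinfun.zero_left blinfun.zero_right)
    then show False using P(1) by (simp add: idempotents_iff)
  qed
  moreover have "R \<noteq> id_blinfun"
  proof
    assume R1: "R = id_blinfun"
    \<comment> \<open>the kernel of \<open>R\<close> contains all \<open>x - P x\<close>\<close>
    have "S 0 = 0" using Sa(2)[of "P 0" "P 0" 0] PE[of 0] by simp
    then have "P x = x" for x
      using R[of x] R[of "x - P x"] by (simp add: R1 blinfun.diff_right Pl)
    then have "P = id_blinfun" by (intro blinfun_eqI) simp
    then show False using P(1) by (simp add: idempotents_iff)
  qed
  moreover have "R (smul c x) = smul c (R x)" for c x
    by (simp add: R Pl Sa(2)[OF PE PE] scale_right_distrib)
  moreover have "R (R x) = R x" for x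
    by (rule trans[OF R[of "R x", unfolded PR] R[of x, symmetric]])
  ultimately have "R \<in> idempotents smul" by (simp add: idempotents_iff)
  moreover have "range R = graph_map E S"
    unfolding graph_map_def P(2)[symmetric] image_image using R by simp
  ultimately show ?thesis using that R by blast
qed

text \<open>
  The map \<open>Q \<mapsto> range Q\<close> is a quotient map. Openness of the preimage in every chart follows
  from openness in the idempotents by pulling back along the continuous \<open>S \<mapsto> P + S P\<close>.
\<close>

lemma openin_grassmann_topology_iff:
  "openin (grassmann_topology smul) U \<longleftrightarrow> U \<subseteq> grassmannian smul \<and>
     openin (top_of_set (idempotents smul)) {Q \<in> idempotents smul. range Q \<in> U}"
proof (intro iffI conjI)
  assume "U \<subseteq> grassmannian smul \<and>
     openin (top_of_set (idempotents smul)) {Q \<in> idempotents smul. range Q \<in> U}"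
  then have UG: "U \<subseteq> grassmannian smul" and
    U: "\<And>Q. Q \<in> idempotents smul \<Longrightarrow> range Q \<in> U \<Longrightarrow>
      \<exists>e>0. \<forall>R\<in>idempotents smul. dist R Q < e \<longrightarrow> range R \<in> U"
    unfolding openin_idempotents_iff by auto
  have "openin (op_topology smul E F) {T \<in> bounded_ops smul E F. graph_map E T \<in> U}"
    if FE: "F \<in> grassmannian smul" "E \<in> closed_complements smul F" for E F
  proof -
    have E: "closed_subspace smul E" using FE by (simp add: closed_complements_def)
    interpret M: Metric_space "bounded_ops smul E F" "op_dist smul E F"
      by (rule Metric_space_bounded_ops[OF E])
    have "(E, F) \<in> complementary_pairs smul"
      using FE closed_complements_grassmannian[OF FE]
      by (auto simp: complementary_pairs_def closed_complements_def)
    then obtain P where P: "P \<in> idempotents smul" "range P = E" "{x. P x = 0} = F"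
      by (rule exists_idempotent)
    have "\<exists>r>0. M.mball S r \<subseteq> {T \<in> bounded_ops smul E F. graph_map E T \<in> U}"
      if S: "S \<in> bounded_ops smul E F" and SU: "graph_map E S \<in> U" for S
    proof -
      obtain Q where Q: "Q \<in> idempotents smul" "range Q = graph_map E S" "\<And>x. Q x = P x + S (P x)"
        using graph_idempotent[OF P S] by blast
      obtain e where e: "e > 0" "\<And>R. R \<in> idempotents smul \<Longrightarrow> dist R Q < e \<Longrightarrow> range R \<in> U"
        using U[of Q] Q SU by auto
      define r where "r = e / (norm P + 1)"
      have np: "norm P + 1 > 0" by (simp add: add_nonneg_pos)
      have r: "r > 0" using e np by (simp add: r_def)
      have "graph_map E T \<in> U" if T: "T \<in> bounded_ops smul E F" and ST: "op_dist smul E F S T < r" for T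
      proof -
        obtain R where R: "R \<in> idempotents smul" "range R = graph_map E T" "\<And>x. R x = P x + T (P x)"
          using graph_idempotent[OF P T] by blast
        have "norm ((Q - R) x) \<le> r * norm P * norm x" for x
        proof -
          have "P x \<in> E" using P(2) by blast
          then have "norm (S (P x) - T (P x)) \<le> op_dist smul E F S T * norm (P x)"
            using norm_diff_le_op_dist[OF _ S T] E by (simp add: closed_subspace_def)
          also have "\<dots> \<le> r * (norm P * norm x)"
            using ST r by (intro mult_mono norm_blinfun) auto
          finally show ?thesis by (simp add: blinfun.diff_left Q(3) R(3) mult.assoc)
        qed
        then have "norm (Q - R) \<le> r * norm P" using r by (intro norm_blinfun_bound) auto
        also have "\<dots> < r * (norm P + 1)" using r by (intro mult_strict_left_mono) auto
        also have "\<dots> = e" using np by (simp add: r_def)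
        finally show ?thesis using e(2)[OF R(1)] R(2) by (simp add: dist_norm norm_minus_commute)
      qed
      then show ?thesis using r by auto
    qed
    then show ?thesis unfolding op_topology_def M.openin_mtopology by auto
  qed
  then show "openin (grassmann_topology smul) U"
    using UG by (simp add: openin_grassmann_topology)
qed (use openin_range_vimage in \<open>auto simp: openin_grassmann_topology\<close>)

lemma topspace_grassmann_topology: "topspace (grassmann_topology smul) = grassmannian smul"
proof -
  have "{Q \<in> idempotents smul. range Q \<in> grassmannian smul} = idempotents smul"
    using range_kernel_grassmannian(1) by blast
  then have "openin (grassmann_topology smul) (grassmannian smul)"
    unfolding openin_grassmann_topology_iff by simp
  then have "grassmannian smul \<subseteq> topspace (grassmann_topology smul)" by (rule openin_subset)
  moreover have "topspace (grassmann_topology smul) \<subseteq> grassmannian smul"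
    using openin_topspace[of "grassmann_topology smul"] unfolding openin_grassmann_topology ..
  ultimately show ?thesis by (rule antisym[rotated])
qed

lemma open_range_image:
  assumes N: "openin (top_of_set (idempotents smul)) N"
  shows "openin (grassmann_topology smul) ((\<lambda>Q. range (blinfun_apply Q)) ` N)"
proof -
  have NI: "N \<subseteq> idempotents smul" using N unfolding openin_idempotents_iff by blast
  have "\<exists>d>0. \<forall>R\<in>idempotents smul. dist R Q < d \<longrightarrow> range R \<in> (\<lambda>Q. range (blinfun_apply Q)) ` N"
    if Q: "Q \<in> idempotents smul" "range Q \<in> (\<lambda>Q. range (blinfun_apply Q)) ` N" for Q
  proof -
    obtain Q' where Q': "Q' \<in> N" "range Q' = range Q" using Q by auto
    obtain e where e: "e > 0" "\<And>R. R \<in> idempotents smul \<Longrightarrow> dist R Q' < e \<Longrightarrow> R \<in> N"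
      using openin_idempotentsE[OF N Q'(1)] by blast
    obtain d where d: "d > 0" "\<And>R. R \<in> idempotents smul \<Longrightarrow> dist R Q < d \<Longrightarrow>
       \<exists>R' \<in> idempotents smul. range (blinfun_apply R') = range R \<and> dist R' Q' < e \<and>
         ({x. Q' x = 0} = {x. Q x = 0} \<longrightarrow> {x. blinfun_apply R' x = 0} = {x. Q x = 0})"
      by (rule nearby_idempotent_with_range[OF Q(1) subsetD[OF NI Q'(1)] Q'(2) e(1)]) (rule that)
    have "range R \<in> (\<lambda>Q. range (blinfun_apply Q)) ` N"
      if R: "R \<in> idempotents smul" "dist R Q < d" for R
    proof -
      obtain R' where R': "R' \<in> idempotents smul" "range R' = range R" "dist R' Q' < e"
        using d(2)[OF R] by blast
      then show ?thesis using e(2)[of R'] by (intro image_eqI[of _ _ R']) auto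
    qed
    then show ?thesis using d(1) by blast
  qed
  moreover have "(\<lambda>Q. range (blinfun_apply Q)) ` N \<subseteq> grassmannian smul"
    using NI range_kernel_grassmannian(1) by blast
  ultimately show ?thesis
    unfolding openin_grassmann_topology_iff openin_idempotents_iff by simp
qed

lemma openin_complement_image:
  assumes N: "openin (top_of_set (idempotents smul)) N"
  shows "openin (top_of_set (idempotents smul)) ((\<lambda>Q. id_blinfun - Q) ` N)"
proof -
  have "id_blinfun - Q \<in> idempotents smul" if "Q \<in> N" for Q
    using that N complement_in_idempotents openin_idempotents_iff by blast
  moreover have "\<exists>e>0. \<forall>R\<in>idempotents smul. dist R (id_blinfun - Q) < e \<longrightarrow> R \<in> (\<lambda>Q. id_blinfun - Q) ` N"
    if QN: "Q \<in> N" for Q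
  proof -
    obtain e where e: "e > 0" "\<And>R. R \<in> idempotents smul \<Longrightarrow> dist R Q < e \<Longrightarrow> R \<in> N"
      using openin_idempotentsE[OF N QN] by blast
    have "R \<in> (\<lambda>Q. id_blinfun - Q) ` N"
      if R: "R \<in> idempotents smul" "dist R (id_blinfun - Q) < e" for R
    proof (rule image_eqI)
      have "id_blinfun - R - Q = - (R - (id_blinfun - Q))" by simp
      then have "dist (id_blinfun - R) Q < e" using R(2) by (simp only: dist_norm norm_minus_cancel)
      then show "id_blinfun - R \<in> N" using e(2) complement_in_idempotents[OF R(1)] by blast
    qed simp
    then show ?thesis using e(1) by blast
  qed
  ultimately show ?thesis unfolding openin_idempotents_iff by blast
qed

lemma open_kernel_image:
  assumes N: "openin (top_of_set (idempotents smul)) N"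
  shows "openin (grassmann_topology smul) ((\<lambda>Q. {x. blinfun_apply Q x = 0}) ` N)"
proof -
  have "(\<lambda>Q. {x. blinfun_apply Q x = 0}) ` N =
    (\<lambda>Q. range (blinfun_apply Q)) ` (\<lambda>Q. id_blinfun - Q) ` N"
    unfolding image_image
    using N by (intro image_cong refl kernel_idempotent) (auto simp: openin_idempotents_iff)
  then show ?thesis using open_range_image[OF openin_complement_image[OF N]] by simp
qed

lemma continuous_range:
  "continuous_map (top_of_set (idempotents smul)) (grassmann_topology smul)
     (\<lambda>Q. range (blinfun_apply Q))"
  unfolding continuous_map_def topspace_grassmann_topology
  using openin_range_vimage range_kernel_grassmannian(1) by auto

lemma continuous_kernel:
  "continuous_map (top_of_set (idempotents smul)) (grassmann_topology smul)
     (\<lambda>Q. {x. blinfun_apply Q x = 0})"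
proof -
  have "continuous_map (top_of_set (idempotents smul)) (top_of_set (idempotents smul))
     (\<lambda>Q. id_blinfun - Q)"
    unfolding continuous_map_subtopology_eu
  proof
    show "continuous_on (idempotents smul) (\<lambda>Q. id_blinfun - Q)"
      by (rule continuous_on_diff[OF continuous_on_const continuous_on_id])
    show "(\<lambda>Q. id_blinfun - Q) \<in> idempotents smul \<rightarrow> idempotents smul"
      by (rule funcsetI) (rule complement_in_idempotents)
  qed
  then have "continuous_map (top_of_set (idempotents smul)) (grassmann_topology smul)
     ((\<lambda>Q. range (blinfun_apply Q)) \<circ> (\<lambda>Q. id_blinfun - Q))"
    using continuous_range by (rule continuous_map_compose)
  then show ?thesis
    by (rule continuous_map_eq) (simp add: kernel_idempotent)
qed

section \<open>The homeomorphism\<close>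

text \<open>
  Since \<open>P Q\<^sub>1 = Q\<^sub>1\<close> and \<open>P (I - Q\<^sub>2) = 0\<close>, the identity \<open>P - Q\<^sub>1 = P (Q\<^sub>2 - Q\<^sub>1)\<close> holds.
  For \<open>Q\<^sub>1\<close> near \<open>Q\<^sub>2\<close> it first bounds the norm of \<open>P\<close> by \<open>2 * norm Q\<^sub>1\<close>, and then the
  distance of \<open>P\<close> from \<open>Q\<^sub>1\<close>.
\<close>

lemma idempotent_of_mixed_pair_near:
  assumes Q: "Q \<in> idempotents smul" "Q1 \<in> idempotents smul" "Q2 \<in> idempotents smul"
    and P: "P \<in> idempotents smul" "range P = range Q1" "{x. P x = 0} = {x. Q2 x = 0}"
    and d: "dist Q1 Q < d" "dist Q2 Q < d" "d \<le> 1 / 4"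
  shows "dist P Q < (4 * norm Q + 2) * d"
proof -
  have d12: "norm (Q2 - Q1) \<le> 2 * d"
    using dist_triangle_less_add[OF d(2), of Q1 d] d(1) by (simp add: dist_norm norm_minus_commute)
  have "P - Q1 = P o\<^sub>L (Q2 - Q1)"
  proof (rule blinfun_eqI)
    fix x
    have "Q1 x \<in> range P" using P(2) by simp
    then have "P (Q1 x) = Q1 x" using range_idempotent[OF P(1)] by simp
    moreover have "x - Q2 x \<in> {x. Q2 x = 0}"
      using Q(3) by (simp add: idempotents_iff blinfun.diff_right)
    then have "P (x - Q2 x) = 0" unfolding P(3)[symmetric] by simp
    ultimately show "(P - Q1) x = (P o\<^sub>L (Q2 - Q1)) x"
      by (simp add: blinfun.diff_left blinfun.diff_right)
  qed
  then have PQ1: "norm (P - Q1) \<le> norm P * (2 * d)"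
    using norm_blinfun_compose[of P "Q2 - Q1"] mult_left_mono[OF d12, of "norm P"] by simp
  have "norm P * (2 * d) \<le> norm P * (1 / 2)" using d(3) by (intro mult_left_mono) auto
  then have "norm P \<le> 2 * norm Q1"
    using PQ1 norm_triangle_ineq2[of P Q1] by simp
  also have "norm Q1 \<le> norm Q + 1 / 4"
    using norm_triangle_ineq2[of Q1 Q] d(1,3) by (simp add: dist_norm)
  finally have "norm P \<le> 2 * norm Q + 1 / 2" by simp
  moreover have "d \<ge> 0" using d(1) zero_le_dist[of Q1 Q] by linarith
  ultimately have "norm P * (2 * d) \<le> (2 * norm Q + 1 / 2) * (2 * d)"
    by (intro mult_right_mono) auto
  then have "dist P Q1 \<le> (4 * norm Q + 1) * d"
    using PQ1 by (simp add: dist_norm algebra_simps)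
  then have "dist P Q < (4 * norm Q + 1) * d + d"
    using d(1) dist_triangle[of P Q Q1] by (simp add: dist_commute)
  then show ?thesis by (simp add: algebra_simps)
qed

text \<open>
  Around the image of \<open>Q\<close> lies the trace of an open rectangle \<open>range ` N \<times> ker ` N\<close>, for a
  small ball \<open>N\<close> around \<open>Q\<close>. A complementary pair in it mixes the range of one element of
  \<open>N\<close> with the kernel of another, and its projection is still near \<open>Q\<close>.
\<close>

lemma open_map_range_kernel:
  "open_map (top_of_set (idempotents smul))
    (subtopology (prod_topology (grassmann_topology smul) (grassmann_topology smul))
      (complementary_pairs smul))
    (\<lambda>Q. (range (blinfun_apply Q), {x. blinfun_apply Q x = 0}))"
  (is "open_map ?I ?Y ?f")
  unfolding open_map_def
proof (intro allI impI)
  fix W assume W: "openin ?I W"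
  have "\<exists>T. openin ?Y T \<and> y \<in> T \<and> T \<subseteq> ?f ` W" if y: "y \<in> ?f ` W" for y
  proof -
    obtain Q where Q: "Q \<in> W" "y = ?f Q" using y by blast
    have QI: "Q \<in> idempotents smul" using Q W openin_idempotents_iff by blast
    obtain e where e: "e > 0" "\<And>R. R \<in> idempotents smul \<Longrightarrow> dist R Q < e \<Longrightarrow> R \<in> W"
      using openin_idempotentsE[OF W Q(1)] by blast
    define c where "c = 4 * norm Q + 2"
    have c: "c > 0" by (simp add: c_def add_nonneg_pos)
    define d where "d = min (1 / 4) (e / c)"
    have d: "d > 0" "d \<le> 1 / 4" using e c unfolding d_def by (simp, intro min.cobounded1)
    have "c * d \<le> c * (e / c)" using c by (intro mult_left_mono) (auto simp: d_def)
    then have cd: "c * d \<le> e" using c by simp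
    define N where "N = idempotents smul \<inter> ball Q d"
    have N: "openin ?I N" by (simp add: N_def openin_open_Int)
    define T where "T = ((\<lambda>Q. range (blinfun_apply Q)) ` N \<times> (\<lambda>Q. {x. blinfun_apply Q x = 0}) ` N)
      \<inter> complementary_pairs smul"
    have "openin ?Y T"
      unfolding T_def
      using open_range_image[OF N] open_kernel_image[OF N]
      by (intro openin_subtopology_Int) (simp add: openin_prod_Times_iff)
    moreover have "y \<in> T"
      using Q(2) QI d(1) range_kernel_complementary_pair[OF QI] by (auto simp: T_def N_def)
    moreover have "T \<subseteq> ?f ` W"
    proof
      fix z assume z: "z \<in> T"
      then obtain Q1 Q2 where Q12: "Q1 \<in> N" "Q2 \<in> N" "z = (range Q1, {x. Q2 x = 0})"
        by (auto simp: T_def)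
      then have "(range Q1, {x. Q2 x = 0}) \<in> complementary_pairs smul" using z by (simp add: T_def)
      then obtain P where P: "P \<in> idempotents smul" "range P = range Q1" "{x. P x = 0} = {x. Q2 x = 0}"
        by (rule exists_idempotent)
      have "dist P Q < c * d"
        unfolding c_def
        using Q12 d by (intro idempotent_of_mixed_pair_near[OF QI _ _ P]) (auto simp: N_def dist_commute)
      then have "P \<in> W" using e(2)[OF P(1)] cd by simp
      then show "z \<in> ?f ` W" using Q12 P by (intro image_eqI[of _ _ P]) auto
    qed
    ultimately show ?thesis by blast
  qed
  then show "openin ?Y (?f ` W)" by (subst openin_subopen) blast
qed

lemma homeomorphic_map_range_kernel:
  "homeomorphic_map (top_of_set (idempotents smul))
    (subtopology (prod_topology (grassmann_topology smul) (grassmann_topology smul))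
      (complementary_pairs smul))
    (\<lambda>Q. (range (blinfun_apply Q), {x. blinfun_apply Q x = 0}))"
  (is "homeomorphic_map ?I ?Y ?f")
proof (rule bijective_open_imp_homeomorphic_map)
  show "continuous_map ?I ?Y ?f"
    using continuous_range continuous_kernel range_kernel_complementary_pair
    by (auto simp: continuous_map_in_subtopology continuous_map_pairedI)
  show "open_map ?I ?Y ?f" by (rule open_map_range_kernel)
  have "topspace ?Y = complementary_pairs smul"
    by (auto simp: topspace_grassmann_topology complementary_pairs_def)
  moreover have "?f ` idempotents smul = complementary_pairs smul"
  proof
    show "?f ` idempotents smul \<subseteq> complementary_pairs smul"
      using range_kernel_complementary_pair by blast
    show "complementary_pairs smul \<subseteq> ?f ` idempotents smul"
    proof
      fix z assume "z \<in> complementary_pairs smul"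
      then obtain Q where "Q \<in> idempotents smul" "range Q = fst z" "{x. Q x = 0} = snd z"
        using exists_idempotent[of "fst z" "snd z"] by auto
      then show "z \<in> ?f ` idempotents smul" by (intro image_eqI[of _ _ Q]) auto
    qed
  qed
  ultimately show "?f ` topspace ?I = topspace ?Y" by simp
  show "inj_on ?f (topspace ?I)"
    by (rule inj_onI) (auto intro: idempotent_eqI)
qed

end

theorem mainTheorem3:
  fixes smul :: "'k::real_or_complex \<Rightarrow> 'a::banach \<Rightarrow> 'a"
  assumes "banach_space_over smul"
    and "dim_gt_one smul"
  shows "homeomorphic_map
    (top_of_set (idempotents smul))
    (subtopology (prod_topology (grassmann_topology smul) (grassmann_topology smul))
      (complementary_pairs smul))
    (\<lambda>Q. (range (blinfun_apply Q), {x. blinfun_apply Q x = 0}))"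
  using banach_space_over.homeomorphic_map_range_kernel[OF assms(1)] .

end
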